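(* Let $\mathscr X\subset\mathbb R^n$ be a bounded open set with smooth boundary $\partial\mathscr X$ and closure $\overline{\mathscr X}$, let $\mathbf b:\mathbb R^n\to\mathbb R^n$ and $\mathbf B:\mathbb R^n\to\mathbb R^{n\times m}$ satisfy the standing assumptions listed in the context, and let $g:\partial\mathscr X\to\mathbb R$ be continuous. Let $v^*$ be the value function, which is the solution of the boundary value problem $$Lv=0\ \text{ in }\mathscr X,\qquad v=g\ \text{ on }\partial\mathscr X.$$ Let $v\in C^2(\mathscr X)\cap C(\overline{\mathscr X})$ satisfy $Lv\le0$ in $\mathscr X$ and $v\le g$ on $\partial\mathscr X$. Then $v$ is a subsolution of this boundary value problem, in the sense that $v^*\ge v$ on $\overline{\mathscr X}$.
   Context: Standing assumptions: $\mathbf W$ is an $m$-dimensional Brownian motion. The functions $\mathbf b=(b_i)_{i=1,\dots,n}$ and $\mathbf B=(b_{ij})_{i=1,\dots,n,\,j=1,\dots,m}$ are continuous on $\mathbb R^n$ and grow at most linearly outside $\mathscr X$. The matrix $\mathbf B$ has full rank, so that the $n\times n$ matrix $\mathbf A=(a_{ij})$, $a_{ij}:=\frac12\sum_{k=1}^m b_{ik}b_{jk}$, is positive definite at every point. For each initial condition $x$ the stochastic differential equation $d\mathbf X=\mathbf b(\mathbf X)dt+\mathbf B(\mathbf X)d\mathbf W$, $\mathbf X(0)=x$, has a unique solution. Operator: $L$ is defined by $-Lf:=\sum_{i,j=1}^n a_{ij}\,\partial_i\partial_j f+\sum_{i=1}^n b_i\,\partial_i f$. Value function: $v^*(x):=E[g(\mathbf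 X(\tau_x))]$, where $\tau_x$ is the first time the solution started at $x$ hits $\partial\mathscr X$; thus $v^*=g$ on $\partial\mathscr X$. It is a standing fact that $v^*\in C^2(\mathscr X)\cap C(\overline{\mathscr X})$ and that $v^*$ solves the boundary value problem in the claim. *)

theory Defs
  imports "HOL-Probability.Probability"
begin

subsection \<open>Spaces of differentiable functions and smooth boundaries\<close>

definition partial_deriv :: "'n::finite \<Rightarrow> (real^'n \<Rightarrow> real) \<Rightarrow> real^'n \<Rightarrow> real" where
  "partial_deriv i f x = frechet_derivative f (at x) (axis i 1)"

text \<open>Meaningful for open \<open>S\<close> only, since the derivatives are taken in the full space.\<close>

fun Ck_on :: "nat \<Rightarrow> (real^'n::finite \<Rightarrow> real) \<Rightarrow> (real^'n) set \<Rightarrow> bool" where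
  "Ck_on 0 f S \<longleftrightarrow> continuous_on S f"
| "Ck_on (Suc k) f S \<longleftrightarrow>
     (\<forall>x\<in>S. f differentiable (at x)) \<and> (\<forall>i. Ck_on k (partial_deriv i f) S)"

definition smooth_boundary :: "(real^'n::finite) set \<Rightarrow> bool" where
  "smooth_boundary D \<longleftrightarrow>
     (\<forall>p\<in>frontier D. \<exists>U \<rho>. open U \<and> p \<in> U \<and> (\<forall>k. Ck_on k \<rho> U) \<and>
        (\<forall>x\<in>U. frechet_derivative \<rho> (at x) \<noteq> (\<lambda>_. 0)) \<and>
        D \<inter> U = {x\<in>U. \<rho> x < 0})"

subsection \<open>The differential operator and the boundary value problem\<close>

definition diffusion_coeff ::
  "(real^'n \<Rightarrow> real^'m^'n) \<Rightarrow> real^'n \<Rightarrow> 'n::finite \<Rightarrow> 'n \<Rightarrow> real" where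
  "diffusion_coeff B x i j = 1/2 * (\<Sum>k\<in>UNIV. B x $ i $ k * B x $ j $ k)"

text \<open>Note the sign: this is minus the generator of the diffusion.\<close>

definition L_op ::
  "(real^'n::finite \<Rightarrow> real^'n) \<Rightarrow> (real^'n \<Rightarrow> real^'m::finite^'n) \<Rightarrow>
     (real^'n \<Rightarrow> real) \<Rightarrow> real^'n \<Rightarrow> real" where
  "L_op b B f x =
     - ((\<Sum>i\<in>UNIV. \<Sum>j\<in>UNIV. diffusion_coeff B x i j * partial_deriv i (partial_deriv j f) x)
        + (\<Sum>i\<in>UNIV. b x $ i * partial_deriv i f x))"

definition solves_bvp ::
  "(real^'n::finite \<Rightarrow> real^'n) \<Rightarrow> (real^'n \<Rightarrow> real^'m::finite^'n) \<Rightarrow> (real^'n) set \<Rightarrow>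
     (real^'n \<Rightarrow> real) \<Rightarrow> (real^'n \<Rightarrow> real) \<Rightarrow> bool" where
  "solves_bvp b B D g v \<longleftrightarrow> (\<forall>x\<in>D. L_op b B v x = 0) \<and> (\<forall>x\<in>frontier D. v x = g x)"

text \<open>Matrices carry the norm of \<open>real^'m^'n\<close>, i.e. the Frobenius norm.\<close>

definition linear_growth_outside ::
  "(real^'n::finite) set \<Rightarrow> (real^'n \<Rightarrow> 'b::real_normed_vector) \<Rightarrow> bool" where
  "linear_growth_outside D f \<longleftrightarrow> (\<exists>C. \<forall>x. x \<notin> D \<longrightarrow> norm (f x) \<le> C * (1 + norm x))"

subsection \<open>Brownian motion and stochastic integrals\<close>

text \<open>Processes and filtrations are functions of \<open>t :: real\<close>, but only times \<open>t \<ge> 0\<close> matter.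
  A filtration on the half-line is extended by \<open>F t = F 0\<close> for \<open>t < 0\<close>.\<close>

definition filtered_prob_space :: "'w measure \<Rightarrow> (real \<Rightarrow> 'w measure) \<Rightarrow> bool" where
  "filtered_prob_space M F \<longleftrightarrow>
     prob_space M \<and> filtration (space M) F \<and> (\<forall>t. subalgebra M (F t))"

definition adapted_continuous ::
  "'w measure \<Rightarrow> (real \<Rightarrow> 'w measure) \<Rightarrow> (real \<Rightarrow> 'w \<Rightarrow> 'b::topological_space) \<Rightarrow> bool" where
  "adapted_continuous M F X \<longleftrightarrow>
     (\<forall>t\<ge>0. X t \<in> borel_measurable (F t)) \<and>
     (\<forall>\<omega>\<in>space M. continuous_on {0..} (\<lambda>t. X t \<omega>))"

definition brownian_motion ::
  "'w measure \<Rightarrow> (real \<Rightarrow> 'w measure) \<Rightarrow> (real \<Rightarrow> 'w \<Rightarrow> real^'m::finite) \<Rightarrow> bool" where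
  "brownian_motion M F W \<longleftrightarrow>
     adapted_continuous M F W \<and>
     (AE \<omega> in M. W 0 \<omega> = 0) \<and>
     (\<forall>s t. 0 \<le> s \<and> s < t \<longrightarrow>
        distributed M lborel (\<lambda>\<omega>. W t \<omega> - W s \<omega>)
          (\<lambda>x. ennreal (\<Prod>k\<in>UNIV. normal_density 0 (sqrt (t - s)) (x $ k))) \<and>
        prob_space.indep_set M (sets (F s))
          (sets (vimage_algebra (space M) (\<lambda>\<omega>. W t \<omega> - W s \<omega>) borel)))"

definition tendsto_zero_in_prob :: "'w measure \<Rightarrow> (nat \<Rightarrow> 'w \<Rightarrow> ennreal) \<Rightarrow> bool" where
  "tendsto_zero_in_prob M Z \<longleftrightarrow>
     (\<forall>k. Z k \<in> borel_measurable M) \<and>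
     (\<forall>e>0. (\<lambda>k. measure M {\<omega>\<in>space M. Z k \<omega> > ennreal e}) \<longlonglongrightarrow> 0)"

definition elementary_process ::
  "'w measure \<Rightarrow> (real \<Rightarrow> 'w measure) \<Rightarrow> nat \<Rightarrow> (nat \<Rightarrow> real) \<Rightarrow>
     (nat \<Rightarrow> 'w \<Rightarrow> real^'m::finite^'n::finite) \<Rightarrow> bool" where
  "elementary_process M F N p \<xi> \<longleftrightarrow>
     0 \<le> p 0 \<and>
     (\<forall>i<N. p i \<le> p (Suc i) \<and> \<xi> i \<in> borel_measurable (F (p i)) \<and>
        (\<exists>C. \<forall>\<omega>\<in>space M. norm (\<xi> i \<omega>) \<le> C))"

definition elementary_value ::
  "nat \<Rightarrow> (nat \<Rightarrow> real) \<Rightarrow> (nat \<Rightarrow> 'w \<Rightarrow> real^'m::finite^'n::finite) \<Rightarrow>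
     real \<Rightarrow> 'w \<Rightarrow> real^'m^'n" where
  "elementary_value N p \<xi> t \<omega> = (\<Sum>i<N. indicator {p i<..p (Suc i)} t *\<^sub>R \<xi> i \<omega>)"

definition elementary_integral ::
  "(real \<Rightarrow> 'w \<Rightarrow> real^'m::finite) \<Rightarrow> nat \<Rightarrow> (nat \<Rightarrow> real) \<Rightarrow>
     (nat \<Rightarrow> 'w \<Rightarrow> real^'m^'n::finite) \<Rightarrow> real \<Rightarrow> 'w \<Rightarrow> real^'n" where
  "elementary_integral W N p \<xi> t \<omega> =
     (\<Sum>i<N. \<xi> i \<omega> *v (W (min t (p (Suc i))) \<omega> - W (min t (p i)) \<omega>))"

text \<open>\<open>I\<close> is a version of the Ito integral process of \<open>H\<close> against \<open>W\<close>: there are elementary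
  processes that approximate \<open>H\<close> in square mean over every \<open>[0,T]\<close>, in probability, and whose
  integrals approximate \<open>I\<close> uniformly on every \<open>[0,T]\<close>, in probability. This determines \<open>I\<close> up
  to indistinguishability, and such an \<open>I\<close> exists whenever \<open>H\<close> is adapted and continuous.\<close>

definition ito_integral ::
  "'w measure \<Rightarrow> (real \<Rightarrow> 'w measure) \<Rightarrow> (real \<Rightarrow> 'w \<Rightarrow> real^'m::finite) \<Rightarrow>
     (real \<Rightarrow> 'w \<Rightarrow> real^'m^'n::finite) \<Rightarrow> (real \<Rightarrow> 'w \<Rightarrow> real^'n) \<Rightarrow> bool" where
  "ito_integral M F W H I \<longleftrightarrow>
     (\<forall>\<omega>\<in>space M. continuous_on {0..} (\<lambda>t. I t \<omega>)) \<and>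
     (\<exists>N p \<xi>. (\<forall>k. elementary_process M F (N k) (p k) (\<xi> k)) \<and>
        (\<forall>T\<ge>0.
           tendsto_zero_in_prob M
             (\<lambda>k \<omega>. \<integral>\<^sup>+t\<in>{0..T}.
                ennreal ((norm (elementary_value (N k) (p k) (\<xi> k) t \<omega> - H t \<omega>))\<^sup>2) \<partial>lborel) \<and>
           tendsto_zero_in_prob M
             (\<lambda>k \<omega>. SUP t\<in>{0..T}.
                ennreal (norm (elementary_integral W (N k) (p k) (\<xi> k) t \<omega> - I t \<omega>)))))"

subsection \<open>The stochastic differential equation and the value function\<close>

definition sde_solution ::
  "'w measure \<Rightarrow> (real \<Rightarrow> 'w measure) \<Rightarrow> (real \<Rightarrow> 'w \<Rightarrow> real^'m::finite) \<Rightarrow>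
     (real^'n::finite \<Rightarrow> real^'n) \<Rightarrow> (real^'n \<Rightarrow> real^'m^'n) \<Rightarrow> real^'n \<Rightarrow>
     (real \<Rightarrow> 'w \<Rightarrow> real^'n) \<Rightarrow> bool" where
  "sde_solution M F W b B x X \<longleftrightarrow>
     adapted_continuous M F X \<and>
     (\<exists>I. ito_integral M F W (\<lambda>t \<omega>. B (X t \<omega>)) I \<and>
        (AE \<omega> in M. \<forall>t\<ge>0. X t \<omega> = x + integral {0..t} (\<lambda>s. b (X s \<omega>)) + I t \<omega>))"

text \<open>Existence and pathwise uniqueness on the given filtered probability space.\<close>

definition sde_uniquely_solvable ::
  "'w measure \<Rightarrow> (real \<Rightarrow> 'w measure) \<Rightarrow> (real \<Rightarrow> 'w \<Rightarrow> real^'m::finite) \<Rightarrow>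
     (real^'n::finite \<Rightarrow> real^'n) \<Rightarrow> (real^'n \<Rightarrow> real^'m^'n) \<Rightarrow> real^'n \<Rightarrow> bool" where
  "sde_uniquely_solvable M F W b B x \<longleftrightarrow>
     (\<exists>X. sde_solution M F W b B x X) \<and>
     (\<forall>X Y. sde_solution M F W b B x X \<and> sde_solution M F W b B x Y \<longrightarrow>
        (AE \<omega> in M. \<forall>t\<ge>0. X t \<omega> = Y t \<omega>))"

text \<open>The hitting time is \<open>\<infinity>\<close> if the set is never reached.\<close>

definition hitting_time :: "(real \<Rightarrow> 'w \<Rightarrow> 'b) \<Rightarrow> 'b set \<Rightarrow> 'w \<Rightarrow> ereal" where
  "hitting_time X S \<omega> = Inf {ereal t | t. 0 \<le> t \<and> X t \<omega> \<in> S}"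

text \<open>\<open>X x\<close> is the solution started at \<open>x\<close>. Paths that never reach the boundary contribute 0;
  they form a null set when \<open>x\<close> lies in the closure of a bounded \<open>D\<close> and the diffusion is
  nondegenerate.\<close>

definition value_function ::
  "'w measure \<Rightarrow> (real^'n::finite \<Rightarrow> real \<Rightarrow> 'w \<Rightarrow> real^'n) \<Rightarrow> (real^'n) set \<Rightarrow>
     (real^'n \<Rightarrow> real) \<Rightarrow> real^'n \<Rightarrow> real" where
  "value_function M X D g x =
     (\<integral>\<omega>. (let \<tau> = hitting_time (X x) (frontier D) \<omega>
           in if \<tau> = \<infinity> then 0 else g (X x (real_of_ereal \<tau>) \<omega>)) \<partial>M)"

end

theory Submission
  imports Defs
begin

text \<open>Only the boundary value problem matters: \<open>vstar\<close> is itself a \<open>C\<^sup>2\<close> solution, so the claim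
  is the weak comparison principle for the elliptic operator \<open>L_op b B\<close>. If \<open>v - vstar\<close> were
  positive somewhere, then for a large \<open>\<gamma>\<close> and a small \<open>\<epsilon>\<close> the function
  \<open>v - vstar + \<epsilon> exp (\<gamma> x\<^sub>i)\<close> would have an interior maximum \<open>y\<close>. The generator, applied to this
  function at \<open>y\<close>, is a sum of second derivatives along the columns of \<open>B y\<close> and one first derivative
  along \<open>b y\<close>, hence at most 0; but the exponential makes it strictly positive.\<close>

text \<open>If \<open>l\<close> were positive, then \<open>f'\<close>, which vanishes at
  \<open>a\<close>, would be positive just to the right of \<open>a\<close>; so \<open>f\<close>
  would increase strictly there and exceed its local maximum.\<close>

lemma second_derivative_nonpos_at_local_max:
  fixes f f' :: "real \<Rightarrow> real"
  assumes deriv: "eventually (\<lambda>t. (f has_real_derivative f' t) (at t)) (nhds a)"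
    and deriv2: "(f' has_real_derivative l) (at a)"
    and max: "eventually (\<lambda>t. f t \<le> f a) (nhds a)"
  shows "f' a = 0" and "l \<le> 0"
proof -
  obtain d where d: "d > 0" "\<And>t. dist t a < d \<Longrightarrow> (f has_real_derivative f' t) (at t)"
      "\<And>t. dist t a < d \<Longrightarrow> f t \<le> f a"
    using eventually_conj[OF deriv max] unfolding eventually_nhds_metric by blast
  show zero: "f' a = 0"
    using DERIV_local_max[OF d(2)[of a] d(1)] d by (auto simp: dist_real_def)
  show "l \<le> 0"
  proof (rule ccontr)
    assume "\<not> l \<le> 0"
    then obtain e where e: "e > 0" "\<And>h. 0 < h \<Longrightarrow> h < e \<Longrightarrow> f' a < f' (a + h)"
      using DERIV_pos_inc_right[OF deriv2] by auto
    define h where "h = min d e / 2"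
    have h: "0 < h" "h < d" "h < e" using d(1) e(1) by (auto simp: h_def)
    \<comment> \<open>The version of the monotonicity rule for open intervals is the right one here,
      because \<open>f'\<close> is zero at \<open>a\<close> itself.\<close>
    have "f a < f (a + h)"
    proof (rule DERIV_pos_imp_increasing_open[of a "a + h" f])
      show "a < a + h" using h by simp
      show "\<exists>y. DERIV f x :> y \<and> y > 0" if "a < x" "x < a + h" for x
      proof -
        have "(f has_real_derivative f' x) (at x)" using that h by (intro d(2)) (auto simp: dist_real_def)
        moreover have "f' x > 0" using e(2)[of "x - a"] that h zero by auto
        ultimately show ?thesis by blast
      qed
      show "continuous_on {a..a + h} f"
        using h by (intro continuous_at_imp_continuous_on ballI DERIV_isCont[OF d(2)])
          (auto simp: dist_real_def)
    qed
    then show False using d(3)[of "a + h"] h by (auto simp: dist_real_def)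
  qed
qed

text \<open>The chain rule, with the direction \<open>c\<close> expanded in the standard basis. Used
  for \<open>f\<close> and then for each \<open>partial_deriv i f\<close>, it gives both derivatives
  of a twice differentiable function along a line.\<close>

lemma has_real_derivative_along_line:
  fixes f :: "real^'n::finite \<Rightarrow> real"
  assumes "f differentiable (at (x + t *\<^sub>R c))"
  shows "((\<lambda>t. f (x + t *\<^sub>R c)) has_real_derivative
      (\<Sum>i\<in>UNIV. c $ i * partial_deriv i f (x + t *\<^sub>R c))) (at t)"
proof -
  define f' where "f' = frechet_derivative f (at (x + t *\<^sub>R c))"
  have f': "(f has_derivative f') (at (x + t *\<^sub>R c))"
    using assms by (simp add: f'_def frechet_derivative_works)
  then have lin: "linear f'" by (rule has_derivative_linear)
  have "((\<lambda>t. f (x + t *\<^sub>R c)) has_derivative (\<lambda>s. f' (s *\<^sub>R c))) (at t)"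
    by (rule has_derivative_compose[where g = f and f = "\<lambda>t. x + t *\<^sub>R c"])
      (auto intro!: derivative_eq_intros f')
  moreover have "f' (s *\<^sub>R c) = (\<Sum>i\<in>UNIV. c $ i * partial_deriv i f (x + t *\<^sub>R c)) * s" for s
  proof -
    have "f' c = f' (\<Sum>i\<in>UNIV. (c $ i) *\<^sub>R axis i 1)"
      by (simp add: basis_expansion flip: scalar_mult_eq_scaleR)
    also have "\<dots> = (\<Sum>i\<in>UNIV. c $ i * f' (axis i 1))"
      by (simp add: linear_sum[OF lin] linear_cmul[OF lin])
    finally show ?thesis
      by (simp add: linear_cmul[OF lin] partial_deriv_def flip: f'_def)
  qed
  ultimately show ?thesis by (simp add: has_field_derivative_def)
qed

lemma Ck_on_2_differentiable:
  assumes "Ck_on 2 f D" "x \<in> D"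
  shows "f differentiable (at x)" and "partial_deriv i f differentiable (at x)"
  using assms by (auto simp: numeral_2_eq_2)

text \<open>Since the diffusion matrix is half the sum of the outer products of the columns of
  \<open>B x\<close>, the second-order part is half a sum of second derivatives along these columns.
  This replaces a diagonalisation of the matrix.\<close>

lemma L_op_eq_columns:
  fixes b :: "real^'n::finite \<Rightarrow> real^'n" and B :: "real^'n \<Rightarrow> real^'m::finite^'n"
  shows "- L_op b B f x =
    (1/2) * (\<Sum>k\<in>UNIV. \<Sum>i\<in>UNIV. B x $ i $ k *
        (\<Sum>j\<in>UNIV. B x $ j $ k * partial_deriv j (partial_deriv i f) x))
      + (\<Sum>i\<in>UNIV. b x $ i * partial_deriv i f x)"
proof -
  have "(\<Sum>i\<in>UNIV. \<Sum>j\<in>UNIV. diffusion_coeff B x i j * partial_deriv i (partial_deriv j f) x) =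
    (\<Sum>i\<in>UNIV. \<Sum>j\<in>UNIV. \<Sum>k\<in>UNIV.
        1/2 * (B x $ i $ k * B x $ j $ k * partial_deriv i (partial_deriv j f) x))"
    unfolding diffusion_coeff_def sum_distrib_left sum_distrib_right
    by (intro sum.cong refl) (simp only: mult.assoc)
  \<comment> \<open>Exchanging the two outer sums brings the index of the inner derivative to the
    front, as in the target; the mixed partial derivatives themselves are never
    interchanged.\<close>
  also have "\<dots> = (\<Sum>j\<in>UNIV. \<Sum>i\<in>UNIV. \<Sum>k\<in>UNIV.
        1/2 * (B x $ i $ k * B x $ j $ k * partial_deriv i (partial_deriv j f) x))"
    by (rule sum.swap)
  also have "\<dots> = (\<Sum>j\<in>UNIV. \<Sum>k\<in>UNIV. \<Sum>i\<in>UNIV.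
        1/2 * (B x $ i $ k * B x $ j $ k * partial_deriv i (partial_deriv j f) x))"
    by (intro sum.cong refl sum.swap)
  also have "\<dots> = (\<Sum>k\<in>UNIV. \<Sum>j\<in>UNIV. \<Sum>i\<in>UNIV.
        1/2 * (B x $ i $ k * B x $ j $ k * partial_deriv i (partial_deriv j f) x))"
    by (rule sum.swap)
  also have "\<dots> = (1/2) * (\<Sum>k\<in>UNIV. \<Sum>i\<in>UNIV. B x $ i $ k *
        (\<Sum>j\<in>UNIV. B x $ j $ k * partial_deriv j (partial_deriv i f) x))"
    unfolding sum_distrib_left by (intro sum.cong refl) (rule arg_cong[where f = "(*) (1/2)"], simp only: mult_ac)
  finally show ?thesis
    by (simp only: L_op_def minus_minus)
qed

text \<open>Full row rank makes \<open>B x\<close> surjective, so its row \<open>i\<close> is not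
  zero; the diagonal coefficient is half the squared length of that row.\<close>

lemma diffusion_coeff_diag_pos:
  fixes B :: "real^'n::finite \<Rightarrow> real^'m::finite^'n"
  assumes "rank (B x) = CARD('n)"
  shows "diffusion_coeff B x i i > 0"
proof -
  have "surj ((*v) (B x))" using assms full_rank_surjective by blast
  then obtain y where y: "B x *v y = axis i 1" by (metis surjD)
  have "\<exists>k. B x $ i $ k \<noteq> 0"
  proof (rule ccontr)
    assume "\<not> (\<exists>k. B x $ i $ k \<noteq> 0)"
    then have "(B x *v y) $ i = 0" by (simp add: matrix_vector_mult_def)
    then show False by (simp add: y axis_def)
  qed
  then obtain k where "B x $ i $ k \<noteq> 0" ..
  then have "(\<Sum>k\<in>UNIV. B x $ i $ k * B x $ i $ k) > 0"
    by (intro sum_pos2[of UNIV k]) (auto simp: zero_less_mult_iff linorder_neq_iff)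
  then show ?thesis by (simp add: diffusion_coeff_def)
qed

text \<open>The left-hand side is the generator applied to the exponential term at \<open>y\<close>.
  One-dimensional calculus on lines through \<open>y\<close> suffices: the columns of
  \<open>B y\<close> give the second-order part, the line along \<open>b y\<close> the first-order
  part.\<close>

lemma L_op_le_at_perturbed_max:
  fixes b :: "real^'n::finite \<Rightarrow> real^'n" and B :: "real^'n \<Rightarrow> real^'m::finite^'n"
  assumes D: "open D" "y \<in> D" and v: "Ck_on 2 v D" and w: "Ck_on 2 w D"
    and max: "\<And>x. x \<in> D \<Longrightarrow>
      v x - w x + \<epsilon> * exp (\<gamma> * x $ i) \<le> v y - w y + \<epsilon> * exp (\<gamma> * y $ i)"
  shows "\<epsilon> * exp (\<gamma> * y $ i) * (\<gamma>\<^sup>2 * diffusion_coeff B y i i + \<gamma> * b y $ i)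
    \<le> L_op b B v y - L_op b B w y"
proof -
  define E where "E = \<epsilon> * exp (\<gamma> * y $ i)"
  define dv where "dv f c x = (\<Sum>i\<in>UNIV. c $ i * partial_deriv i f x)"
    for f and c x :: "real^'n"
  define d2 where "d2 f c = (\<Sum>i\<in>UNIV. c $ i * (\<Sum>j\<in>UNIV. c $ j * partial_deriv j (partial_deriv i f) y))"
    for f and c :: "real^'n"
  \<comment> \<open>The first-order statement has to be an equation, since the drift enters with no
    definite sign. On the line the exponential depends on \<open>t * c $ i\<close> only, so each
    derivative contributes a factor \<open>\<gamma> * c $ i\<close>.\<close>
  have along: "dv v c y - dv w c y + E * \<gamma> * c $ i = 0"
      "d2 v c - d2 w c + E * \<gamma>\<^sup>2 * (c $ i)\<^sup>2 \<le> 0" for c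
  proof -
    define \<phi> where "\<phi> t = v (y + t *\<^sub>R c) - w (y + t *\<^sub>R c) + \<epsilon> * exp (\<gamma> * (y $ i + t * c $ i))" for t
    define \<phi>' where "\<phi>' t = dv v c (y + t *\<^sub>R c) - dv w c (y + t *\<^sub>R c)
        + \<epsilon> * exp (\<gamma> * (y $ i + t * c $ i)) * (\<gamma> * c $ i)" for t
    have "((\<lambda>t. y + t *\<^sub>R c) \<longlongrightarrow> y + 0 *\<^sub>R c) (nhds 0)"
      by (intro tendsto_intros filterlim_ident)
    then have inD: "eventually (\<lambda>t. y + t *\<^sub>R c \<in> D) (nhds 0)"
      using D by (intro topological_tendstoD) auto
    have 1: "eventually (\<lambda>t. (\<phi> has_real_derivative \<phi>' t) (at t)) (nhds 0)"
      using inD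
    proof eventually_elim
      case (elim t)
      have "((\<lambda>t. f (y + t *\<^sub>R c)) has_real_derivative dv f c (y + t *\<^sub>R c)) (at t)"
        if "Ck_on 2 f D" for f
        unfolding dv_def
        by (rule has_real_derivative_along_line) (rule Ck_on_2_differentiable[OF that elim])
      note this[OF v, derivative_intros] this[OF w, derivative_intros]
      show ?case unfolding \<phi>_def \<phi>'_def by (auto intro!: derivative_eq_intros)
    qed
    have "((\<lambda>t. dv f c (y + t *\<^sub>R c)) has_real_derivative d2 f c) (at 0)" if "Ck_on 2 f D" for f
    proof -
      have "((\<lambda>t. partial_deriv i f (y + t *\<^sub>R c)) has_real_derivative
          (\<Sum>j\<in>UNIV. c $ j * partial_deriv j (partial_deriv i f) y)) (at 0)" for i
        using has_real_derivative_along_line[of "partial_deriv i f" y 0 c]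
          Ck_on_2_differentiable(2)[OF that D(2)] by simp
      then show ?thesis unfolding dv_def d2_def by (intro DERIV_sum DERIV_cmult)
    qed
    note this[OF v, derivative_intros] this[OF w, derivative_intros]
    then have 2: "(\<phi>' has_real_derivative d2 v c - d2 w c + E * \<gamma>\<^sup>2 * (c $ i)\<^sup>2) (at 0)"
      unfolding \<phi>'_def E_def
      by (auto intro!: derivative_eq_intros simp: power2_eq_square)
    have 3: "eventually (\<lambda>t. \<phi> t \<le> \<phi> 0) (nhds 0)"
      using inD 
    proof eventually_elim
      case (elim t)
      show ?case using max[OF elim] by (simp add: \<phi>_def)
    qed
    show "dv v c y - dv w c y + E * \<gamma> * c $ i = 0"
      using second_derivative_nonpos_at_local_max(1)[OF 1 2 3] by (simp add: \<phi>'_def E_def mult_ac)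
    show "d2 v c - d2 w c + E * \<gamma>\<^sup>2 * (c $ i)\<^sup>2 \<le> 0"
      by (rule second_derivative_nonpos_at_local_max(2)[OF 1 2 3])
  qed
  have L: "- L_op b B f y = (1/2) * (\<Sum>k\<in>UNIV. d2 f (column k (B y))) + dv f (b y) y" for f
    unfolding L_op_eq_columns d2_def dv_def by (simp add: column_def)
  have "(\<Sum>k\<in>UNIV. d2 v (column k (B y)) - d2 w (column k (B y))
      + E * \<gamma>\<^sup>2 * (column k (B y) $ i)\<^sup>2) \<le> 0"
    by (intro sum_nonpos along)
  \<comment> \<open>The factor 2 cancels the 1/2 in \<open>diffusion_coeff\<close>.\<close>
  moreover have "(\<Sum>k\<in>UNIV. E * \<gamma>\<^sup>2 * (column k (B y) $ i)\<^sup>2) = 2 * E * \<gamma>\<^sup>2 * diffusion_coeff B y i i"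
    by (simp add: diffusion_coeff_def column_def power2_eq_square sum_distrib_left mult.assoc)
  ultimately have "(\<Sum>k\<in>UNIV. d2 v (column k (B y))) - (\<Sum>k\<in>UNIV. d2 w (column k (B y)))
      + 2 * E * \<gamma>\<^sup>2 * diffusion_coeff B y i i \<le> 0"
    by (simp add: sum.distrib sum_subtractf)
  then show ?thesis
    using along(1)[of "b y"] L[of v] L[of w] unfolding E_def[symmetric]
    by (simp add: algebra_simps)
qed

text \<open>An interior maximum of \<open>v - w\<close> alone would not contradict the weak
  inequality between \<open>L_op b B v\<close> and \<open>L_op b B w\<close>; the exponential
  supplies strictness. Compactness of the closure lets \<open>\<gamma>\<close> and
  \<open>\<epsilon>\<close> be fixed before the maximum point is known.\<close>

lemma elliptic_comparison_principle:
  fixes b :: "real^'n::finite \<Rightarrow> real^'n" and B :: "real^'n \<Rightarrow> real^'m::finite^'n"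
  assumes "open D" "bounded D"
    and b: "continuous_on (closure D) b" and B: "continuous_on (closure D) B"
    and rank: "\<And>x. x \<in> closure D \<Longrightarrow> rank (B x) = CARD('n)"
    and v: "Ck_on 2 v D" "continuous_on (closure D) v"
    and w: "Ck_on 2 w D" "continuous_on (closure D) w"
    and L: "\<And>x. x \<in> D \<Longrightarrow> L_op b B v x \<le> L_op b B w x"
    and bd: "\<And>x. x \<in> frontier D \<Longrightarrow> v x \<le> w x"
    and z: "z \<in> closure D"
  shows "v z \<le> w z"
proof (rule ccontr)
  assume neg: "\<not> v z \<le> w z"
  \<comment> \<open>Any coordinate will do; there is one because types are nonempty.\<close>
  fix i :: 'n
  let ?a = "\<lambda>x. diffusion_coeff B x i i"
  have cpt: "compact (closure D)" using \<open>bounded D\<close> by simp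
  have a_pos: "?a x > 0" if "x \<in> closure D" for x
    using rank[OF that] by (rule diffusion_coeff_diag_pos)
  have "continuous_on (closure D) ?a"
    unfolding diffusion_coeff_def by (intro continuous_intros B)
  then have "continuous_on (closure D) (\<lambda>x. b x $ i / ?a x)"
    using a_pos by (intro continuous_intros b) (auto simp: less_le)
  then have "bounded ((\<lambda>x. b x $ i / ?a x) ` closure D)"
    by (intro compact_imp_bounded compact_continuous_image cpt)
  then obtain K where K: "K > 0" "\<And>x. x \<in> closure D \<Longrightarrow> \<bar>b x $ i / ?a x\<bar> \<le> K"
    unfolding bounded_pos by auto
  \<comment> \<open>Then \<open>\<gamma> + b x $ i / ?a x\<close> is at least 1 on the closure, so
    the second-order term of the exponential outweighs the drift term.\<close>
  define \<gamma> where "\<gamma> = K + 1"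
  have \<gamma>: "\<gamma>\<^sup>2 * ?a x + \<gamma> * b x $ i > 0" if "x \<in> closure D" for x
  proof -
    have "0 < \<gamma> * (?a x * (\<gamma> + b x $ i / ?a x))"
      using abs_le_D2[OF K(2)[OF that]] K(1) a_pos[OF that] by (intro mult_pos_pos) (auto simp: \<gamma>_def)
    also have "?a x * (\<gamma> + b x $ i / ?a x) = \<gamma> * ?a x + b x $ i"
      using a_pos[OF that] by (simp add: distrib_left)
    finally show ?thesis by (simp only: power2_eq_square distrib_left mult.assoc)
  qed
  have "continuous_on (closure D) (\<lambda>x. exp (\<gamma> * x $ i))" by (intro continuous_intros)
  then have "bounded ((\<lambda>x. exp (\<gamma> * x $ i)) ` closure D)"
    by (intro compact_imp_bounded compact_continuous_image cpt)
  then obtain C where C: "C > 0" "\<And>x. x \<in> closure D \<Longrightarrow> exp (\<gamma> * x $ i) \<le> C"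
    unfolding bounded_pos by auto
  \<comment> \<open>With this choice \<open>h\<close> is at most
    \<open>\<epsilon> * C = v z - w z\<close> on the frontier, whereas \<open>h z\<close> is
    strictly larger because the exponential is positive. This forces the maximum into the
    interior.\<close>
  define \<epsilon> where "\<epsilon> = (v z - w z) / C"
  have \<epsilon>: "\<epsilon> > 0" "\<epsilon> * C = v z - w z" using neg C(1) by (auto simp: \<epsilon>_def)
  define h where "h x = v x - w x + \<epsilon> * exp (\<gamma> * x $ i)" for x
  have "continuous_on (closure D) h" unfolding h_def by (intro continuous_intros v w)
  then obtain y where y: "y \<in> closure D" "\<And>x. x \<in> closure D \<Longrightarrow> h x \<le> h y"
    using continuous_attains_sup[OF cpt, of h] z by fastforce
  have "y \<notin> frontier D"
  proof
    assume "y \<in> frontier D"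
    then have "h y \<le> \<epsilon> * exp (\<gamma> * y $ i)" using bd[of y] by (simp add: h_def)
    also have "\<dots> \<le> \<epsilon> * C" by (intro mult_left_mono C(2)[OF y(1)] less_imp_le[OF \<epsilon>(1)])
    also have "\<dots> < h z" unfolding \<epsilon>(2) h_def using \<epsilon>(1) by simp
    finally show False using y(2)[OF z] by linarith
  qed
  then have "y \<in> D" using y(1) \<open>open D\<close> by (simp add: frontier_def interior_open)
  have "\<epsilon> * exp (\<gamma> * y $ i) * (\<gamma>\<^sup>2 * ?a y + \<gamma> * b y $ i) \<le> L_op b B v y - L_op b B w y"
    by (rule L_op_le_at_perturbed_max[OF \<open>open D\<close> \<open>y \<in> D\<close> v(1) w(1)])
      (use y(2) subsetD[OF closure_subset[of D]] in \<open>simp add: h_def\<close>)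
  also have "\<dots> \<le> 0" using L[OF \<open>y \<in> D\<close>] by simp
  finally have "\<epsilon> * exp (\<gamma> * y $ i) * (\<gamma>\<^sup>2 * ?a y + \<gamma> * b y $ i) \<le> 0" .
  moreover have "\<epsilon> * exp (\<gamma> * y $ i) * (\<gamma>\<^sup>2 * ?a y + \<gamma> * b y $ i) > 0"
    by (intro mult_pos_pos \<epsilon>(1) \<gamma>[OF y(1)] exp_gt_zero)
  ultimately show False by linarith
qed

theorem lemma3:
  fixes M :: "'w measure" and F :: "real \<Rightarrow> 'w measure"
    and W :: "real \<Rightarrow> 'w \<Rightarrow> real^'m::finite"
    and b :: "real^'n::finite \<Rightarrow> real^'n" and B :: "real^'n \<Rightarrow> real^'m^'n"
    and X :: "real^'n \<Rightarrow> real \<Rightarrow> 'w \<Rightarrow> real^'n"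
    and D :: "(real^'n) set" and g v vstar :: "real^'n \<Rightarrow> real"
  assumes "open D" and "bounded D" and "smooth_boundary D"
    and "filtered_prob_space M F" and "brownian_motion M F W"
    and "continuous_on UNIV b" and "continuous_on UNIV B"
    and "linear_growth_outside D b" and "linear_growth_outside D B"
    and "\<forall>x. rank (B x) = CARD('n)"
    and "\<forall>x. sde_uniquely_solvable M F W b B x"
    and "\<forall>x. sde_solution M F W b B x (X x)"
    and "continuous_on (frontier D) g"
    and "vstar = value_function M X D g"
    and "Ck_on 2 vstar D" and "continuous_on (closure D) vstar"
    and "solves_bvp b B D g vstar"
    and "Ck_on 2 v D" and "continuous_on (closure D) v"
    and "\<forall>x\<in>D. L_op b B v x \<le> 0" and "\<forall>x\<in>frontier D. v x \<le> g x"
  shows "\<forall>x\<in>closure D. vstar x \<ge> v x"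
proof
  fix z assume z: "z \<in> closure D"
  show "vstar z \<ge> v z"
  \<comment> \<open>Here \<open>vstar\<close> is the upper function: \<open>L_op b B vstar\<close>
    vanishes in \<open>D\<close>, and \<open>vstar\<close> equals \<open>g\<close> on the
    frontier.\<close>
  proof (rule elliptic_comparison_principle)
    show "continuous_on (closure D) b" "continuous_on (closure D) B"
      using assms(6,7) continuous_on_subset[OF _ subset_UNIV] by blast+
    show "rank (B x) = CARD('n)" for x
      using assms(10) by blast
    show "L_op b B v x \<le> L_op b B vstar x" if "x \<in> D" for x
      using assms(17,20) that by (simp add: solves_bvp_def)
    show "v x \<le> vstar x" if "x \<in> frontier D" for x
      using assms(17,21) that by (simp add: solves_bvp_def)
  qed (fact assms z)+
qed

end
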